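(* Let $G$ be an infinite closed subgroup of $\mathrm{Sym}(\mathbb{N})$ that is locally Roelcke precompact. Let $\mathcal{W}(G)$ be the set of cosets of Roelcke precompact open subgroups of $G$, together with $\emptyset$. Then the range of the natural monomorphism $\Gamma:\mathrm{Aut}(G)\to\mathrm{Sym}(\mathcal{W}(G))$, given by $\Gamma(\alpha)(A)=\alpha(A)$, is closed.
   Context: A topological group $G$ is Roelcke precompact if each open subgroup $U$ of $G$ has only finitely many double cosets $UgU$, $g\in G$. $G$ is locally Roelcke precompact if it has a Roelcke precompact open subgroup. $\mathrm{Aut}(G)$ is the group of bicontinuous automorphisms of $G$. For such $G$, $\mathcal{W}(G)$ is a countable basis of the topology of $G$ invariant under the action of $\mathrm{Aut}(G)$. $\mathrm{Sym}(X)$ for countable $X$ carries the topology of pointwise convergence ($X$ discrete), in which the pointwise stabilisers of finite subsets of $X$ form a neighbourhood basis of the identity. *)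

theory Defs
  imports "HOL-Analysis.Analysis" "HOL-Algebra.Bij" "HOL-Algebra.Left_Coset"
begin

section \<open>Topological groups\<close>

locale topological_group = group G for G :: "('a, 'b) monoid_scheme" (structure) +
  fixes T :: "'a topology"
  assumes topspace_eq_carrier: "topspace T = carrier G"
    and continuous_mult: "continuous_map (prod_topology T T) T (\<lambda>(x, y). x \<otimes> y)"
    and continuous_inv: "continuous_map T T (\<lambda>x. inv x)"

definition open_subgroup :: "'a set \<Rightarrow> ('a, 'b) monoid_scheme \<Rightarrow> 'a topology \<Rightarrow> bool" where
  "open_subgroup U G T \<longleftrightarrow> subgroup U G \<and> openin T U"

definition roelcke_precompact :: "('a, 'b) monoid_scheme \<Rightarrow> 'a topology \<Rightarrow> bool" where
  "roelcke_precompact G T \<longleftrightarrow> topological_group G T \<and>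
     (\<forall>U. open_subgroup U G T \<longrightarrow> finite {U <#>\<^bsub>G\<^esub> (g <#\<^bsub>G\<^esub> U) |g. g \<in> carrier G})"

text \<open>A subgroup \<open>U\<close> of \<open>G\<close> is Roelcke precompact if it is so as a topological group in its
  own right: only the double cosets \<open>VgV\<close> with \<open>g \<in> U\<close>, for open subgroups \<open>V\<close> of \<open>U\<close>, count.\<close>

definition roelcke_precompact_open_subgroup ::
    "'a set \<Rightarrow> ('a, 'b) monoid_scheme \<Rightarrow> 'a topology \<Rightarrow> bool" where
  "roelcke_precompact_open_subgroup U G T \<longleftrightarrow>
     open_subgroup U G T \<and> roelcke_precompact (G\<lparr>carrier := U\<rparr>) (subtopology T U)"

definition locally_roelcke_precompact :: "('a, 'b) monoid_scheme \<Rightarrow> 'a topology \<Rightarrow> bool" where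
  "locally_roelcke_precompact G T \<longleftrightarrow> topological_group G T \<and>
     (\<exists>U. roelcke_precompact_open_subgroup U G T)"

text \<open>The group of bicontinuous automorphisms. As in \<^const>\<open>AutoGroup\<close>, automorphisms are
  extensional functions on the carrier.\<close>

definition top_auto :: "('a, 'b) monoid_scheme \<Rightarrow> 'a topology \<Rightarrow> ('a \<Rightarrow> 'a) set" where
  "top_auto G T = {\<alpha> \<in> auto G. homeomorphic_map T T \<alpha>}"

definition TopAutoGroup :: "('a, 'b) monoid_scheme \<Rightarrow> 'a topology \<Rightarrow> ('a \<Rightarrow> 'a) monoid" where
  "TopAutoGroup G T = (AutoGroup G)\<lparr>carrier := top_auto G T\<rparr>"


section \<open>The set of cosets and the action on it\<close>

text \<open>Left and right cosets are both listed, but either kind alone gives the same set, since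
  \<open>gU = (gUg\<^sup>-\<^sup>1)g\<close> and conjugation preserves Roelcke precompact open subgroups.\<close>

definition rp_cosets :: "('a, 'b) monoid_scheme \<Rightarrow> 'a topology \<Rightarrow> 'a set set" where
  "rp_cosets G T =
     insert {} (\<Union>U \<in> {U. roelcke_precompact_open_subgroup U G T}.
                  lcosets\<^bsub>G\<^esub> U \<union> rcosets\<^bsub>G\<^esub> U)"

definition coset_action ::
    "('a, 'b) monoid_scheme \<Rightarrow> 'a topology \<Rightarrow> ('a \<Rightarrow> 'a) \<Rightarrow> 'a set \<Rightarrow> 'a set" where
  "coset_action G T \<alpha> = (\<lambda>A \<in> rp_cosets G T. \<alpha> ` A)"


section \<open>Symmetric groups with the topology of pointwise convergence\<close>

definition sym_topology :: "'a set \<Rightarrow> ('a \<Rightarrow> 'a) topology" where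
  "sym_topology X = subtopology (product_topology (\<lambda>_. discrete_topology X) X) (Bij X)"

lemma topspace_sym_topology [simp]: "topspace (sym_topology X) = Bij X"
  unfolding sym_topology_def by (auto simp: Bij_def bij_betw_def PiE_def)

lemma continuous_map_into_sym:
  assumes "F \<in> topspace T \<rightarrow> Bij X"
    and "\<And>x y. x \<in> X \<Longrightarrow> y \<in> X \<Longrightarrow> openin T {t \<in> topspace T. F t x = y}"
  shows "continuous_map T (sym_topology X) F"
proof -
  have 1: "continuous_map T (discrete_topology X) (\<lambda>t. F t x)" if x: "x \<in> X" for x
  proof -
    have "openin T {t \<in> topspace T. F t x \<in> U}" if "U \<subseteq> X" for U
    proof -
      have "{t \<in> topspace T. F t x \<in> U} = (\<Union>y\<in>U. {t \<in> topspace T. F t x = y})"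
        by auto
      moreover have "openin T (\<Union>y\<in>U. {t \<in> topspace T. F t x = y})"
        using assms(2) x that by (intro openin_Union) auto
      ultimately show ?thesis by simp
    qed
    moreover have "F t x \<in> X" if "t \<in> topspace T" for t
      using assms(1) x that by (auto simp: Bij_def bij_betw_def)
    ultimately show ?thesis by (auto simp: continuous_map_def)
  qed
  show ?thesis
    unfolding sym_topology_def continuous_map_in_subtopology continuous_map_componentwise
    using assms(1) 1 by (auto simp: Bij_def)
qed

lemma openin_sym_topology_point:
  assumes "x \<in> X" shows "openin (sym_topology X) {f \<in> Bij X. f x = y}"
proof (cases "y \<in> X")
  case True
  have "continuous_map (sym_topology X) (discrete_topology X) (\<lambda>f. f x)"
    unfolding sym_topology_def
    by (intro continuous_map_from_subtopology continuous_map_product_projection assms)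
  from openin_continuous_map_preimage[OF this, of "{y}"] show ?thesis using True by simp
next
  case False
  have "{f \<in> Bij X. f x = y} = {}"
    using assms False by (auto simp: Bij_def bij_betw_def)
  then show ?thesis by (simp only: openin_empty)
qed

lemma topological_group_sym: "topological_group (BijGroup X) (sym_topology X)"
proof -
  interpret B: group "BijGroup X" by (rule group_BijGroup)
  let ?S = "sym_topology X"
  have carr: "carrier (BijGroup X) = Bij X" by (simp add: BijGroup_def)
  have mult: "f \<otimes>\<^bsub>BijGroup X\<^esub> g = compose X f g" if "f \<in> Bij X" "g \<in> Bij X" for f g
    using that by (simp add: BijGroup_def)
  have cm: "continuous_map (prod_topology ?S ?S) ?S (\<lambda>(f, g). f \<otimes>\<^bsub>BijGroup X\<^esub> g)"
  proof (rule continuous_map_into_sym)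
    show "(\<lambda>(f, g). f \<otimes>\<^bsub>BijGroup X\<^esub> g) \<in> topspace (prod_topology ?S ?S) \<rightarrow> Bij X"
      by (auto simp: mult compose_Bij)
    fix x y assume x: "x \<in> X" and y: "y \<in> X"
    have mem: "g x \<in> X" if "g \<in> Bij X" for g
      using Bij_imp_funcset[OF that] x by auto
    have "{t \<in> topspace (prod_topology ?S ?S). (case t of (f, g) \<Rightarrow> f \<otimes>\<^bsub>BijGroup X\<^esub> g) x = y}
      = (\<Union>z\<in>X. {f \<in> Bij X. f z = y} \<times> {g \<in> Bij X. g x = z})"
      using x mem by (auto simp: mult compose_def)
    also have "openin (prod_topology ?S ?S) \<dots>"
      by (intro openin_Union ballI)
         (auto simp: openin_prod_Times_iff openin_sym_topology_point x)
    finally show "openin (prod_topology ?S ?S)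
      {t \<in> topspace (prod_topology ?S ?S). (case t of (f, g) \<Rightarrow> f \<otimes>\<^bsub>BijGroup X\<^esub> g) x = y}" .
  qed
  have ci: "continuous_map ?S ?S (\<lambda>f. inv\<^bsub>BijGroup X\<^esub> f)"
  proof (rule continuous_map_into_sym)
    show "(\<lambda>f. inv\<^bsub>BijGroup X\<^esub> f) \<in> topspace ?S \<rightarrow> Bij X"
      using B.inv_closed by (auto simp: carr)
    fix x y assume x: "x \<in> X" and y: "y \<in> X"
    have "(inv\<^bsub>BijGroup X\<^esub> f) x = y \<longleftrightarrow> f y = x" if f: "f \<in> Bij X" for f
    proof -
      have "(inv\<^bsub>BijGroup X\<^esub> f) x = inv_into X f x"
        by (simp add: inv_BijGroup f x)
      moreover have "inj_on f X" "f ` X = X"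
        using f by (auto simp: Bij_def bij_betw_def)
      ultimately show ?thesis
        using x y by (metis f_inv_into_f inv_into_f_f)
    qed
    then have "{f \<in> topspace ?S. (inv\<^bsub>BijGroup X\<^esub> f) x = y} = {f \<in> Bij X. f y = x}"
      by (auto simp only: topspace_sym_topology)
    then show "openin ?S {f \<in> topspace ?S. (inv\<^bsub>BijGroup X\<^esub> f) x = y}"
      by (simp add: openin_sym_topology_point y)
  qed
  show ?thesis
    by unfold_locales (use cm ci in \<open>simp_all add: carr\<close>)
qed

lemma (in topological_group) topological_group_subgroup:
  assumes "subgroup H G"
  shows "topological_group (G\<lparr>carrier := H\<rparr>) (subtopology T H)"
proof -
  interpret H: group "G\<lparr>carrier := H\<rparr>" by (rule subgroup.subgroup_is_group[OF assms is_group])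
  have sub: "H \<subseteq> carrier G" using assms by (rule subgroup.subset)
  have top: "topspace (subtopology T H) = H" using sub by (auto simp: topspace_eq_carrier)
  have "continuous_map (prod_topology (subtopology T H) (subtopology T H)) (subtopology T H)
      (\<lambda>(x, y). x \<otimes> y)"
    unfolding continuous_map_in_subtopology prod_topology_subtopology subtopology_subtopology
    using continuous_mult subgroup.m_closed[OF assms]
    by (auto intro: continuous_map_from_subtopology)
  moreover have "continuous_map (subtopology T H) (subtopology T H) (\<lambda>x. inv x)"
    unfolding continuous_map_in_subtopology
    using continuous_inv subgroup.m_inv_closed[OF assms]
    by (auto intro: continuous_map_from_subtopology)
  then have "continuous_map (subtopology T H) (subtopology T H) (\<lambda>x. inv\<^bsub>G\<lparr>carrier := H\<rparr>\<^esub> x)"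
    by (rule continuous_map_eq) (simp add: top m_inv_consistent[OF assms])
  ultimately show ?thesis
    by unfold_locales (use top in simp_all)
qed

end

theory Submission
  imports Defs
begin

text \<open>A map \<open>f\<close> in the closure of the range agrees on any finitely many cosets with the image map of
  a topological automorphism, so it preserves every finitary relation between cosets that such
  automorphisms preserve; the same holds for its inverse. For \<open>g \<in> G\<close> the sets \<open>f(A)\<close> with
  \<open>g \<in> A\<close> are closed, have the finite intersection property, and include a left and a right coset
  of every Roelcke precompact open subgroup. By Raikov completeness of \<open>G\<close> they have a common
  point \<open>\<phi>(g)\<close>. The map obtained in this way from the inverse of \<open>f\<close> inverts \<open>\<phi>\<close>, hence
  \<open>\<phi>(A) = f(A)\<close> for all cosets, which makes \<open>\<phi>\<close> a homeomorphism; continuity of the product and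
  one more finite approximation make it multiplicative.\<close>

section \<open>The symmetric group\<close>

lemma openin_sym_topology_agree:
  assumes "finite F" "F \<subseteq> X"
  shows "openin (sym_topology X) {h \<in> Bij X. \<forall>x\<in>F. h x = f x}"
  using assms
proof (induction F)
  case empty
  show ?case using openin_topspace[of "sym_topology X"] by simp
next
  case (insert x F)
  have "{h \<in> Bij X. \<forall>x\<in>insert x F. h x = f x}
      = {h \<in> Bij X. h x = f x} \<inter> {h \<in> Bij X. \<forall>x\<in>F. h x = f x}" by auto
  then show ?case using insert by (simp add: openin_Int openin_sym_topology_point)
qed

lemma sym_topology_nbhd:
  assumes "openin (sym_topology X) U" "f \<in> U"
  obtains F where "finite F" "F \<subseteq> X" "{h \<in> Bij X. \<forall>x\<in>F. h x = f x} \<subseteq> U"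
proof -
  obtain U' where U': "openin (product_topology (\<lambda>_. discrete_topology X) X) U'" "U = U' \<inter> Bij X"
    using assms(1) by (auto simp: sym_topology_def openin_subtopology)
  then obtain Y where Y: "f \<in> Pi\<^sub>E X Y" "finite {i. Y i \<noteq> X}" "Pi\<^sub>E X Y \<subseteq> U'"
    using product_topology_open_contains_basis[OF U'(1), of f] assms(2) by auto
  \<comment> \<open>Coordinates with \<open>Y i = X\<close> impose nothing on a bijection of X. The
    remaining ones are finitely many, and there agreement with f suffices.\<close>
  let ?F = "X \<inter> {i. Y i \<noteq> X}"
  have "{h \<in> Bij X. \<forall>x\<in>?F. h x = f x} \<subseteq> U"
  proof
    fix h assume h: "h \<in> {h \<in> Bij X. \<forall>x\<in>?F. h x = f x}"
    have "h x \<in> Y x" if "x \<in> X" for x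
    proof (cases "Y x = X")
      case True
      then show ?thesis using h that Bij_imp_funcset by blast
    next
      case False
      then show ?thesis using h that Y(1) by auto
    qed
    then have "h \<in> Pi\<^sub>E X Y" using h Bij_imp_extensional by (auto simp: PiE_iff)
    then show "h \<in> U" using Y U' h by auto
  qed
  then show ?thesis using that[of ?F] Y(2) by auto
qed

text \<open>Basic neighbourhoods prescribe finitely many values, so the closure of S consists of the
  bijections that agree on each finite set with some member of S. Both completeness and closedness
  of the range are tested in this form.\<close>

lemma closedin_sym_topology_iff:
  "closedin (sym_topology X) S \<longleftrightarrow> S \<subseteq> Bij X \<and>
    (\<forall>f\<in>Bij X. (\<forall>F. finite F \<longrightarrow> F \<subseteq> X \<longrightarrow> (\<exists>h\<in>S. \<forall>x\<in>F. h x = f x)) \<longrightarrow> f \<in> S)"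
  (is "?L \<longleftrightarrow> ?R")
proof
  assume L: ?L
  have "f \<in> S" if f: "f \<in> Bij X" "\<forall>F. finite F \<longrightarrow> F \<subseteq> X \<longrightarrow> (\<exists>h\<in>S. \<forall>x\<in>F. h x = f x)" for f
  proof (rule ccontr)
    assume "f \<notin> S"
    moreover have "openin (sym_topology X) (Bij X - S)"
      using L by (simp add: closedin_def)
    ultimately obtain F where "finite F" "F \<subseteq> X" "{h \<in> Bij X. \<forall>x\<in>F. h x = f x} \<subseteq> Bij X - S"
      using f(1) sym_topology_nbhd[of X "Bij X - S" f] by blast
    moreover obtain h where "h \<in> S" "\<forall>x\<in>F. h x = f x" using f(2) calculation by blast
    ultimately show False using closedin_subset[OF L] by auto
  qed
  then show ?R using closedin_subset[OF L] by auto
next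
  assume R: ?R
  have "\<exists>U. openin (sym_topology X) U \<and> f \<in> U \<and> U \<subseteq> Bij X - S" if "f \<in> Bij X - S" for f
  proof -
    have "f \<in> Bij X" "f \<notin> S" using that by auto
    then have "\<not> (\<forall>F. finite F \<longrightarrow> F \<subseteq> X \<longrightarrow> (\<exists>h\<in>S. \<forall>x\<in>F. h x = f x))"
      using bspec[OF conjunct2[OF R], of f] by satx
    then obtain F where "finite F" "F \<subseteq> X" "\<not> (\<exists>h\<in>S. \<forall>x\<in>F. h x = f x)" by meson
    then have "{h \<in> Bij X. \<forall>x\<in>F. h x = f x} \<subseteq> Bij X - S" by blast
    moreover have "f \<in> {h \<in> Bij X. \<forall>x\<in>F. h x = f x}" using that by simp
    ultimately show ?thesis
      using openin_sym_topology_agree[OF \<open>finite F\<close> \<open>F \<subseteq> X\<close>, of f] by blast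
  qed
  then have "openin (sym_topology X) (Bij X - S)" by (subst openin_subopen) blast
  then show ?L using R by (simp add: closedin_def)
qed

text \<open>Raikov completeness of the symmetric group. The second condition on \<open>\<C>\<close> controls the
  inverses; without it the limit need only be injective.\<close>

lemma sym_topology_complete:
  assumes closed: "\<And>C. C \<in> \<C> \<Longrightarrow> closedin (sym_topology X) C"
    and fip: "\<And>\<D>. finite \<D> \<Longrightarrow> \<D> \<subseteq> \<C> \<Longrightarrow> Bij X \<inter> \<Inter>\<D> \<noteq> {}"
    and left: "\<And>x. x \<in> X \<Longrightarrow> \<exists>C\<in>\<C>. \<exists>y. \<forall>h\<in>C. h x = y"
    and right: "\<And>y. y \<in> X \<Longrightarrow> \<exists>C\<in>\<C>. \<exists>x\<in>X. \<forall>h\<in>C. h x = y"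
  shows "\<exists>b\<in>Bij X. \<forall>C\<in>\<C>. b \<in> C"
proof -
  \<comment> \<open>\<open>C x\<close> is a member of the family all of whose elements take the same
    value \<open>b x\<close> at x; these forced values are the only candidate for the limit.\<close>
  obtain C b where C: "\<And>x. x \<in> X \<Longrightarrow> C x \<in> \<C>" "\<And>x h. x \<in> X \<Longrightarrow> h \<in> C x \<Longrightarrow> h x = b x"
    using left by metis
  define \<beta> where "\<beta> = restrict b X"
  have approx: "\<exists>h\<in>Bij X. h \<in> \<Inter>\<D> \<and> (\<forall>x\<in>F. h x = \<beta> x)"
    if "finite F" "F \<subseteq> X" "finite \<D>" "\<D> \<subseteq> \<C>" for F \<D>
  proof -
    \<comment> \<open>Adjoining the finitely many sets \<open>C x\<close> for x in F forces a common
      point to have the candidate values on F.\<close>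
    have "Bij X \<inter> \<Inter>(\<D> \<union> C ` F) \<noteq> {}" using that C by (intro fip) auto
    then obtain h where "h \<in> Bij X" "h \<in> \<Inter>(\<D> \<union> C ` F)" by blast
    then show ?thesis using C that by (intro bexI[of _ h]) (auto simp: \<beta>_def)
  qed
  have "inj_on \<beta> X"
  proof (rule inj_onI)
    fix x y assume xy: "x \<in> X" "y \<in> X" "\<beta> x = \<beta> y"
    obtain h where "h \<in> Bij X" "h x = \<beta> x" "h y = \<beta> y" using approx[of "{x,y}" "{}"] xy by auto
    then show "x = y" using xy by (auto simp: Bij_def bij_betw_def inj_on_def)
  qed
  moreover have "\<beta> x \<in> X" if "x \<in> X" for x
  proof -
    obtain h where "h \<in> Bij X" "h x = \<beta> x" using approx[of "{x}" "{}"] \<open>x \<in> X\<close> by auto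
    then show ?thesis using funcset_mem[OF Bij_imp_funcset[of h X] \<open>x \<in> X\<close>] by simp
  qed
  moreover have "y \<in> \<beta> ` X" if y: "y \<in> X" for y
  proof -
    \<comment> \<open>Every element of D sends x to y, and some element of D agrees with \<beta> at
      x; hence \<beta> x = y.\<close>
    obtain D x where D: "D \<in> \<C>" "x \<in> X" "\<forall>h\<in>D. h x = y" using right[OF y] by blast
    then obtain h where "h \<in> D" "h x = \<beta> x" using approx[of "{x}" "{D}"] by auto
    then show ?thesis using D by auto
  qed
  ultimately have \<beta>: "\<beta> \<in> Bij X" by (auto simp: Bij_def bij_betw_def \<beta>_def)
  moreover have "\<beta> \<in> D" if D: "D \<in> \<C>" for D
  proof -
    have "\<exists>h\<in>D. \<forall>x\<in>F. h x = \<beta> x" if "finite F" "F \<subseteq> X" for F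
      using approx[of F "{D}"] that D by auto
    then show ?thesis using closed[OF D] \<beta> unfolding closedin_sym_topology_iff by blast
  qed
  ultimately show ?thesis by blast
qed

section \<open>Roelcke precompact open subgroups and their cosets\<close>

context topological_group
begin

section \<open>Translations, open subgroups and Roelcke precompactness\<close>

lemma continuous_map_mult_left:
  assumes "a \<in> carrier G" shows "continuous_map T T (\<lambda>x. a \<otimes> x)"
proof -
  have "continuous_map T (prod_topology T T) (\<lambda>x. (a, x))"
    using assms by (simp add: continuous_map_paired topspace_eq_carrier)
  from continuous_map_compose[OF this continuous_mult] show ?thesis by (simp add: o_def)
qed

lemma continuous_map_mult_right:
  assumes "a \<in> carrier G" shows "continuous_map T T (\<lambda>x. x \<otimes> a)"
proof -
  have "continuous_map T (prod_topology T T) (\<lambda>x. (x, a))"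
    using assms by (simp add: continuous_map_paired topspace_eq_carrier)
  from continuous_map_compose[OF this continuous_mult] show ?thesis by (simp add: o_def)
qed

text \<open>A translate is the preimage under the inverse translation, which is continuous; openness
  and closedness of cosets both follow from this form.\<close>

lemma l_coset_eq_preimage:
  assumes "A \<subseteq> carrier G" "a \<in> carrier G"
  shows "a <# A = {x \<in> topspace T. inv a \<otimes> x \<in> A}"
proof -
  have "x = a \<otimes> (inv a \<otimes> x)" if "x \<in> carrier G" for x
    using that assms by (simp add: m_assoc[symmetric])
  moreover have "inv a \<otimes> (a \<otimes> x) = x" if "x \<in> A" for x
    using that assms by (metis subsetD inv_closed l_inv l_one m_assoc)
  ultimately show ?thesis using assms by (fastforce simp: l_coset_def topspace_eq_carrier)
qed

lemma r_coset_eq_preimage: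
  assumes "A \<subseteq> carrier G" "a \<in> carrier G"
  shows "A #> a = {x \<in> topspace T. x \<otimes> inv a \<in> A}"
proof -
  have "x = (x \<otimes> inv a) \<otimes> a" if "x \<in> carrier G" for x
    using that assms by (simp add: m_assoc)
  moreover have "(x \<otimes> a) \<otimes> inv a = x" if "x \<in> A" for x
    using that assms by (metis subsetD inv_closed r_inv r_one m_assoc)
  ultimately show ?thesis using assms by (fastforce simp: r_coset_def topspace_eq_carrier)
qed

lemma openin_l_coset: "openin T A \<Longrightarrow> a \<in> carrier G \<Longrightarrow> openin T (a <# A)"
  using openin_continuous_map_preimage[OF continuous_map_mult_left[of "inv a"], of A]
    openin_subset[of T A]
  by (simp add: topspace_eq_carrier l_coset_eq_preimage)

lemma openin_r_coset: "openin T A \<Longrightarrow> a \<in> carrier G \<Longrightarrow> openin T (A #> a)"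
  using openin_continuous_map_preimage[OF continuous_map_mult_right[of "inv a"], of A]
    openin_subset[of T A]
  by (simp add: topspace_eq_carrier r_coset_eq_preimage)

lemma closedin_l_coset: "closedin T A \<Longrightarrow> a \<in> carrier G \<Longrightarrow> closedin T (a <# A)"
  using closedin_continuous_map_preimage[OF continuous_map_mult_left[of "inv a"], of A]
    closedin_subset[of T A]
  by (simp add: topspace_eq_carrier l_coset_eq_preimage)

lemma closedin_r_coset: "closedin T A \<Longrightarrow> a \<in> carrier G \<Longrightarrow> closedin T (A #> a)"
  using closedin_continuous_map_preimage[OF continuous_map_mult_right[of "inv a"], of A]
    closedin_subset[of T A]
  by (simp add: topspace_eq_carrier r_coset_eq_preimage)

text \<open>The complement of U is the union of the left cosets of elements outside U, and each of
  these is open.\<close>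

lemma open_subgroup_closedin:
  assumes "open_subgroup U G T" shows "closedin T U"
proof -
  have U: "subgroup U G" "openin T U" using assms by (auto simp: open_subgroup_def)
  interpret U: subgroup U G by fact
  have "x \<notin> U" if x: "x \<in> h <# U" "h \<in> carrier G" "h \<notin> U" for x h
  proof
    assume "x \<in> U"
    moreover have "h \<in> x <# U"
      using x U.lcos_module_imp[OF is_group x(2) x(1)] U.lcos_module_rev[OF is_group, of x h]
        U.mem_carrier[OF \<open>x \<in> U\<close>] U.m_inv_closed inv_mult_group by fastforce
    ultimately show False using x(3) by (auto simp: l_coset_def)
  qed
  then have "carrier G - U = (\<Union>h\<in>carrier G - U. h <# U)"
    using lcos_self[OF _ U(1)] l_coset_subset_G[OF U.subset] by blast
  moreover have "openin T (\<Union>h\<in>carrier G - U. h <# U)"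
    using U by (intro openin_Union) (auto intro: openin_l_coset)
  ultimately show ?thesis using U.subset by (simp add: closedin_def topspace_eq_carrier)
qed

text \<open>Since U is open, the open subgroups of U in the subspace topology are exactly the open
  subgroups of G inside U, and products are computed as in G. The condition can therefore be checked
  without changing the group.\<close>

lemma roelcke_precompact_open_subgroup_iff:
  "roelcke_precompact_open_subgroup U G T \<longleftrightarrow> open_subgroup U G T \<and>
    (\<forall>V. open_subgroup V G T \<longrightarrow> V \<subseteq> U \<longrightarrow> finite {V <#> (g <# V) |g. g \<in> U})"
proof (cases "open_subgroup U G T")
  case True
  then have U: "subgroup U G" "openin T U" by (auto simp: open_subgroup_def)
  have "open_subgroup V (G\<lparr>carrier := U\<rparr>) (subtopology T U) \<longleftrightarrow> open_subgroup V G T \<and> V \<subseteq> U" for V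
    using U subgroup_incl incl_subgroup[OF U(1)] subgroup.subset[of V "G\<lparr>carrier := U\<rparr>"]
    by (auto simp: open_subgroup_def openin_open_subtopology)
  then show ?thesis
    using True topological_group_subgroup[OF U(1)]
    by (auto simp: roelcke_precompact_open_subgroup_def roelcke_precompact_def
        set_mult_def l_coset_def)
qed (simp add: roelcke_precompact_open_subgroup_def)

text \<open>For S inside V, the double cosets SgS with g in V are among those with g in U. This
  later produces arbitrarily small Roelcke precompact subgroups.\<close>

lemma roelcke_precompact_open_subgroup_mono:
  assumes "roelcke_precompact_open_subgroup U G T" "open_subgroup V G T" "V \<subseteq> U"
  shows "roelcke_precompact_open_subgroup V G T"
  unfolding roelcke_precompact_open_subgroup_iff
proof (intro conjI allI impI)
  fix S assume S: "open_subgroup S G T" "S \<subseteq> V"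
  then have "finite {S <#> (g <# S) |g. g \<in> U}"
    using assms by (auto simp: roelcke_precompact_open_subgroup_iff)
  moreover have "{S <#> (g <# S) |g. g \<in> V} \<subseteq> {S <#> (g <# S) |g. g \<in> U}" using assms by auto
  ultimately show "finite {S <#> (g <# S) |g. g \<in> V}" by (rule rev_finite_subset)
qed fact

section \<open>Topological automorphisms\<close>

lemma top_autoD:
  assumes "\<alpha> \<in> top_auto G T"
  shows "\<alpha> \<in> Bij (carrier G)" "homeomorphic_map T T \<alpha>" "\<alpha> \<in> extensional (carrier G)"
    "\<And>x. x \<in> carrier G \<Longrightarrow> \<alpha> x \<in> carrier G"
    "\<And>x y. x \<in> carrier G \<Longrightarrow> y \<in> carrier G \<Longrightarrow> \<alpha> (x \<otimes> y) = \<alpha> x \<otimes> \<alpha> y"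
    "inj_on \<alpha> (carrier G)" "\<alpha> ` carrier G = carrier G" "group_hom G G \<alpha>"
  using assms by (auto simp: top_auto_def auto_def Bij_def bij_betw_def hom_def group_hom_def
      group_hom_axioms_def is_group)

lemma top_autoI:
  assumes "\<alpha> \<in> extensional (carrier G)" "homeomorphic_map T T \<alpha>"
    "\<And>x y. x \<in> carrier G \<Longrightarrow> y \<in> carrier G \<Longrightarrow> \<alpha> (x \<otimes> y) = \<alpha> x \<otimes> \<alpha> y"
  shows "\<alpha> \<in> top_auto G T"
  using assms by (auto simp: top_auto_def auto_def Bij_def bij_betw_def hom_def
      homeomorphic_eq_everything_map topspace_eq_carrier)

lemma top_auto_compose:
  assumes "\<alpha> \<in> top_auto G T" "\<beta> \<in> top_auto G T"
  shows "compose (carrier G) \<alpha> \<beta> \<in> top_auto G T"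
proof (rule top_autoI)
  show "homeomorphic_map T T (compose (carrier G) \<alpha> \<beta>)"
    using homeomorphic_map_compose[OF top_autoD(2)[OF assms(2)] top_autoD(2)[OF assms(1)]]
    by (rule homeomorphic_map_eq) (simp add: compose_def topspace_eq_carrier)
qed (use assms in \<open>auto simp: compose_def top_autoD\<close>)

lemma top_auto_inverse:
  assumes "\<alpha> \<in> top_auto G T"
  shows "\<exists>\<beta>\<in>top_auto G T. (\<forall>x\<in>carrier G. \<alpha> (\<beta> x) = x) \<and> (\<forall>x\<in>carrier G. \<beta> (\<alpha> x) = x)"
proof -
  note \<alpha> = top_autoD[OF assms]
  obtain \<gamma> where \<gamma>: "homeomorphic_maps T T \<alpha> \<gamma>" using \<alpha>(2) homeomorphic_map_maps by blast
  \<comment> \<open>Members of \<open>auto G\<close> are extensional, hence the restriction to the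
    carrier.\<close>
  define \<beta> where "\<beta> = restrict \<gamma> (carrier G)"
  have inverse: "\<alpha> (\<beta> x) = x" "\<beta> (\<alpha> x) = x" if "x \<in> carrier G" for x
    using \<gamma> that \<alpha> by (auto simp: homeomorphic_maps_def \<beta>_def topspace_eq_carrier)
  have homeo: "homeomorphic_map T T \<beta>"
    using \<gamma> homeomorphic_map_eq[of T T \<gamma> \<beta>]
    by (auto simp: homeomorphic_maps_map \<beta>_def topspace_eq_carrier)
  then have closed: "\<beta> x \<in> carrier G" if "x \<in> carrier G" for x
    using that by (auto simp: homeomorphic_eq_everything_map topspace_eq_carrier)
  have "\<beta> \<in> top_auto G T"
  proof (rule top_autoI[OF _ homeo])
    fix x y assume xy: "x \<in> carrier G" "y \<in> carrier G"
    have "\<beta> (x \<otimes> y) = \<beta> (\<alpha> (\<beta> x) \<otimes> \<alpha> (\<beta> y))" using xy inverse by simp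
    also have "\<dots> = \<beta> (\<alpha> (\<beta> x \<otimes> \<beta> y))" using xy closed \<alpha> by simp
    also have "\<dots> = \<beta> x \<otimes> \<beta> y" using xy closed inverse by simp
    finally show "\<beta> (x \<otimes> y) = \<beta> x \<otimes> \<beta> y" .
  qed (simp add: \<beta>_def)
  with inverse show ?thesis by blast
qed

lemma top_auto_image_set_mult:
  assumes "\<alpha> \<in> top_auto G T" "A \<subseteq> carrier G" "B \<subseteq> carrier G"
  shows "\<alpha> ` (A <#> B) = \<alpha> ` A <#> \<alpha> ` B"
proof -
  have "\<alpha> (a \<otimes> b) = \<alpha> a \<otimes> \<alpha> b" if "a \<in> A" "b \<in> B" for a b
    using that assms(2,3) top_autoD(5)[OF assms(1)] by blast
  then show ?thesis by (simp add: set_mult_def image_UN)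
qed

lemma top_auto_image_l_coset:
  assumes "\<alpha> \<in> top_auto G T" "a \<in> carrier G" "A \<subseteq> carrier G"
  shows "\<alpha> ` (a <# A) = \<alpha> a <# \<alpha> ` A"
  using top_auto_image_set_mult[OF assms(1), of "{a}" A] assms
  by (simp add: l_coset_eq_set_mult)

lemma top_auto_image_r_coset:
  assumes "\<alpha> \<in> top_auto G T" "a \<in> carrier G" "A \<subseteq> carrier G"
  shows "\<alpha> ` (A #> a) = \<alpha> ` A #> \<alpha> a"
  using top_auto_image_set_mult[OF assms(1), of A "{a}"] assms
  by (simp add: r_coset_eq_set_mult)

lemma top_auto_image_open_subgroup:
  assumes "\<alpha> \<in> top_auto G T" "open_subgroup U G T"
  shows "open_subgroup (\<alpha> ` U) G T"
  using assms group_hom.subgroup_img_is_subgroup[OF top_autoD(8)[OF assms(1)]]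
    homeomorphic_map_openness_eq[OF top_autoD(2)[OF assms(1)], of U]
  unfolding open_subgroup_def by blast

text \<open>An open subgroup V of \<alpha>(U) pulls back along the inverse \<beta> to an open
  subgroup \<beta>(V) of U, whose finitely many double cosets are carried by \<alpha> onto those of
  V.\<close>

lemma top_auto_image_roelcke_precompact:
  assumes \<alpha>: "\<alpha> \<in> top_auto G T" and U: "roelcke_precompact_open_subgroup U G T"
  shows "roelcke_precompact_open_subgroup (\<alpha> ` U) G T"
  unfolding roelcke_precompact_open_subgroup_iff
proof (intro conjI allI impI)
  have oU: "open_subgroup U G T" using U by (simp add: roelcke_precompact_open_subgroup_def)
  then have Uc: "U \<subseteq> carrier G" by (simp add: open_subgroup_def subgroup.subset)
  show "open_subgroup (\<alpha> ` U) G T" by (rule top_auto_image_open_subgroup[OF \<alpha> oU])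
  fix V assume V: "open_subgroup V G T" "V \<subseteq> \<alpha> ` U"
  obtain \<beta> where \<beta>: "\<beta> \<in> top_auto G T" "\<And>x. x \<in> carrier G \<Longrightarrow> \<alpha> (\<beta> x) = x"
    "\<And>x. x \<in> carrier G \<Longrightarrow> \<beta> (\<alpha> x) = x" using top_auto_inverse[OF \<alpha>] by blast
  have oV: "open_subgroup (\<beta> ` V) G T" by (rule top_auto_image_open_subgroup[OF \<beta>(1) V(1)])
  have Vc: "\<beta> ` V \<subseteq> carrier G" using oV by (simp add: open_subgroup_def subgroup.subset)
  have VU: "\<beta> ` V \<subseteq> U"
  proof
    fix y assume "y \<in> \<beta> ` V"
    then obtain u where "u \<in> U" "y = \<beta> (\<alpha> u)" using V(2) by blast
    then show "y \<in> U" using \<beta>(3) Uc by auto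
  qed
  have \<alpha>\<beta>V: "\<alpha> ` (\<beta> ` V) = V"
  proof -
    have "(\<lambda>x. \<alpha> (\<beta> x)) ` V = (\<lambda>x. x) ` V"
      using V(1) \<beta>(2) subgroup.subset[of V G] by (intro image_cong) (auto simp: open_subgroup_def)
    then show ?thesis by (simp add: image_image)
  qed
  have "V <#> (\<alpha> g <# V) = \<alpha> ` (\<beta> ` V <#> (g <# \<beta> ` V))" if "g \<in> U" for g
  proof -
    have "g \<in> carrier G" using that Uc by blast
    then show ?thesis
      using top_auto_image_set_mult[OF \<alpha> Vc l_coset_subset_G[OF Vc]]
        top_auto_image_l_coset[OF \<alpha> _ Vc] by (simp add: \<alpha>\<beta>V)
  qed
  then have "{V <#> (g <# V) |g. g \<in> \<alpha> ` U}
      \<subseteq> (`) \<alpha> ` {\<beta> ` V <#> (g <# \<beta> ` V) |g. g \<in> U}" by auto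
  moreover have "finite {\<beta> ` V <#> (g <# \<beta> ` V) |g. g \<in> U}"
    using U oV VU by (auto simp: roelcke_precompact_open_subgroup_iff)
  ultimately show "finite {V <#> (g <# V) |g. g \<in> \<alpha> ` U}" by (meson finite_imageI finite_subset)
qed

section \<open>Cosets of Roelcke precompact open subgroups\<close>

lemma rp_cosets_cases:
  assumes "A \<in> rp_cosets G T"
  obtains "A = {}"
  | U a where "roelcke_precompact_open_subgroup U G T" "a \<in> carrier G" "A = a <# U"
  | U a where "roelcke_precompact_open_subgroup U G T" "a \<in> carrier G" "A = U #> a"
  using assms by (auto simp: rp_cosets_def LCOSETS_def RCOSETS_def)

lemma rp_open_subgroupD:
  assumes "roelcke_precompact_open_subgroup U G T"
  shows "subgroup U G" "openin T U" "U \<subseteq> carrier G" "\<one> \<in> U" "open_subgroup U G T"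
  using assms by (auto simp: roelcke_precompact_open_subgroup_def open_subgroup_def
      subgroup.subset subgroup.one_closed)

lemma rp_cosetsI:
  assumes "roelcke_precompact_open_subgroup U G T" "a \<in> carrier G"
  shows "a <# U \<in> rp_cosets G T" "U #> a \<in> rp_cosets G T" "U \<in> rp_cosets G T"
proof -
  have *: "a <# U \<in> rp_cosets G T" "U #> a \<in> rp_cosets G T" if "a \<in> carrier G" for a
    using assms(1) that by (auto simp: rp_cosets_def LCOSETS_def RCOSETS_def)
  show "U \<in> rp_cosets G T"
    using *(1)[of \<one>] rp_open_subgroupD[OF assms(1)] by (simp add: lcos_mult_one)
  show "a <# U \<in> rp_cosets G T" "U #> a \<in> rp_cosets G T" using * assms(2) by auto
qed

lemma openin_rp_cosets: "A \<in> rp_cosets G T \<Longrightarrow> openin T A"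
  by (auto elim!: rp_cosets_cases intro: openin_l_coset openin_r_coset rp_open_subgroupD)

text \<open>Open subgroups are closed, and so are their translates. This allows the sets f(A) to
  enter the completeness assumption.\<close>

lemma closedin_rp_cosets: "A \<in> rp_cosets G T \<Longrightarrow> closedin T A"
  by (auto elim!: rp_cosets_cases
      intro: closedin_l_coset closedin_r_coset open_subgroup_closedin rp_open_subgroupD)

lemma rp_cosets_subset: "A \<in> rp_cosets G T \<Longrightarrow> A \<subseteq> carrier G"
  using openin_rp_cosets openin_subset topspace_eq_carrier by blast

lemma top_auto_image_rp_cosets:
  assumes \<alpha>: "\<alpha> \<in> top_auto G T" and "A \<in> rp_cosets G T"
  shows "\<alpha> ` A \<in> rp_cosets G T"
  using assms(2)
proof (cases rule: rp_cosets_cases)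
  case 1
  then show ?thesis by (simp add: rp_cosets_def)
next
  case (2 U a)
  then show ?thesis
    using top_auto_image_roelcke_precompact[OF \<alpha>] top_auto_image_l_coset[OF \<alpha>]
    by (simp add: rp_cosetsI rp_open_subgroupD top_autoD(4)[OF \<alpha>])
next
  case (3 U a)
  then show ?thesis
    using top_auto_image_roelcke_precompact[OF \<alpha>] top_auto_image_r_coset[OF \<alpha>]
    by (simp add: rp_cosetsI rp_open_subgroupD top_autoD(4)[OF \<alpha>])
qed

lemma top_auto_inverse_image:
  assumes "\<And>x. x \<in> carrier G \<Longrightarrow> \<alpha> (\<beta> x) = x" "A \<in> rp_cosets G T"
  shows "\<alpha> ` \<beta> ` A = A"
proof -
  have "(\<lambda>x. \<alpha> (\<beta> x)) ` A = (\<lambda>x. x) ` A"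
    using assms(1) rp_cosets_subset[OF assms(2)] by (intro image_cong) auto
  then show ?thesis by (simp add: image_image)
qed

section \<open>The action of automorphisms on cosets\<close>

lemma coset_action_Bij:
  assumes \<alpha>: "\<alpha> \<in> top_auto G T"
  shows "coset_action G T \<alpha> \<in> Bij (rp_cosets G T)"
proof -
  obtain \<beta> where \<beta>: "\<beta> \<in> top_auto G T" "\<And>x. x \<in> carrier G \<Longrightarrow> \<alpha> (\<beta> x) = x"
    "\<And>x. x \<in> carrier G \<Longrightarrow> \<beta> (\<alpha> x) = x" using top_auto_inverse[OF \<alpha>] by blast
  have "bij_betw (coset_action G T \<alpha>) (rp_cosets G T) (rp_cosets G T)"
    by (rule bij_betwI[where g = "(`) \<beta>"])
      (auto simp: coset_action_def top_auto_image_rp_cosets[OF \<alpha>] top_auto_image_rp_cosets[OF \<beta>(1)]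
        top_auto_inverse_image[of \<alpha> \<beta>, OF \<beta>(2)] top_auto_inverse_image[of \<beta> \<alpha>, OF \<beta>(3)] simp del: image_image)
  then show ?thesis by (simp add: Bij_def coset_action_def)
qed

lemma carrier_TopAutoGroup: "carrier (TopAutoGroup G T) = top_auto G T"
  by (simp add: TopAutoGroup_def)

lemma coset_action_hom: "coset_action G T \<in> hom (TopAutoGroup G T) (BijGroup (rp_cosets G T))"
proof (rule homI)
  fix \<alpha> \<beta> assume "\<alpha> \<in> carrier (TopAutoGroup G T)" "\<beta> \<in> carrier (TopAutoGroup G T)"
  then have \<alpha>: "\<alpha> \<in> top_auto G T" and \<beta>: "\<beta> \<in> top_auto G T" by (auto simp: carrier_TopAutoGroup)
  have "\<alpha> \<otimes>\<^bsub>TopAutoGroup G T\<^esub> \<beta> = compose (carrier G) \<alpha> \<beta>"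
    using top_autoD(1)[OF \<alpha>] top_autoD(1)[OF \<beta>]
    by (simp add: TopAutoGroup_def AutoGroup_def BijGroup_def)
  moreover have "coset_action G T (compose (carrier G) \<alpha> \<beta>)
      = compose (rp_cosets G T) (coset_action G T \<alpha>) (coset_action G T \<beta>)"
  proof
    fix A
    have "compose (carrier G) \<alpha> \<beta> ` A = \<alpha> ` \<beta> ` A" if "A \<in> rp_cosets G T"
      unfolding image_image
      using rp_cosets_subset[OF that] by (intro image_cong) (auto simp: compose_def)
    then show "coset_action G T (compose (carrier G) \<alpha> \<beta>) A
      = compose (rp_cosets G T) (coset_action G T \<alpha>) (coset_action G T \<beta>) A"
      using top_auto_image_rp_cosets[OF \<beta>, of A]
      by (auto simp: coset_action_def compose_def)
  qed
  ultimately show "coset_action G T (\<alpha> \<otimes>\<^bsub>TopAutoGroup G T\<^esub> \<beta>)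
      = coset_action G T \<alpha> \<otimes>\<^bsub>BijGroup (rp_cosets G T)\<^esub> coset_action G T \<beta>"
    using coset_action_Bij[OF \<alpha>] coset_action_Bij[OF \<beta>] by (simp add: BijGroup_def)
qed (simp add: carrier_TopAutoGroup BijGroup_def coset_action_Bij)

end

section \<open>Closedness of the range\<close>

text \<open>The last assumption is Raikov completeness, stated for families of closed sets.\<close>

locale complete_rp_group = topological_group +
  assumes hausdorff: "Hausdorff_space T"
    and small_rp: "\<And>N. openin T N \<Longrightarrow> \<one> \<in> N \<Longrightarrow>
      \<exists>V. roelcke_precompact_open_subgroup V G T \<and> V \<subseteq> N"
    and complete: "\<And>\<C>. (\<And>C. C \<in> \<C> \<Longrightarrow> closedin T C) \<Longrightarrow>
      (\<And>\<D>. finite \<D> \<Longrightarrow> \<D> \<subseteq> \<C> \<Longrightarrow> carrier G \<inter> \<Inter>\<D> \<noteq> {}) \<Longrightarrow>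
      (\<And>V. roelcke_precompact_open_subgroup V G T \<Longrightarrow> \<exists>C\<in>\<C>. \<exists>g\<in>carrier G. C \<subseteq> g <# V) \<Longrightarrow>
      (\<And>V. roelcke_precompact_open_subgroup V G T \<Longrightarrow> \<exists>C\<in>\<C>. \<exists>g\<in>carrier G. C \<subseteq> V #> g) \<Longrightarrow>
      \<exists>x\<in>carrier G. \<forall>C\<in>\<C>. x \<in> C"
begin

section \<open>Cosets as a basis separating points\<close>

lemma rp_cosets_basis:
  assumes "openin T N" "g \<in> N"
  obtains A where "A \<in> rp_cosets G T" "g \<in> A" "A \<subseteq> N"
proof -
  have g: "g \<in> carrier G" using assms openin_subset topspace_eq_carrier by blast
  \<comment> \<open>Translating N back by g gives a neighbourhood of the unit; for a small subgroup
    V inside it, \<open>g <# V\<close> lies in N.\<close>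
  have "openin T {x \<in> topspace T. g \<otimes> x \<in> N}"
    using openin_continuous_map_preimage[OF continuous_map_mult_left[OF g] assms(1)] .
  then obtain V where V: "roelcke_precompact_open_subgroup V G T"
      "V \<subseteq> {x \<in> topspace T. g \<otimes> x \<in> N}"
    using small_rp[of "{x \<in> topspace T. g \<otimes> x \<in> N}"] assms g by (auto simp: topspace_eq_carrier)
  show ?thesis
    using that[of "g <# V"] rp_cosetsI(1)[OF V(1) g] V(2)
      lcos_self[OF g rp_open_subgroupD(1)[OF V(1)]] by (auto simp: l_coset_def)
qed

text \<open>Serves to prove equalities between elements of G: two points lying in the same cosets
  coincide.\<close>

lemma rp_cosets_separate:
  assumes "x \<in> carrier G" "y \<in> carrier G" "x \<noteq> y"
  obtains A where "A \<in> rp_cosets G T" "x \<in> A" "y \<notin> A"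
proof -
  obtain N M where "openin T N" "openin T M" "x \<in> N" "y \<in> M" "disjnt N M"
    using hausdorff assms unfolding Hausdorff_space_def topspace_eq_carrier by blast
  moreover obtain A where "A \<in> rp_cosets G T" "x \<in> A" "A \<subseteq> N"
    using rp_cosets_basis[of N x] calculation by blast
  ultimately show ?thesis using that[of A] by (auto simp: disjnt_iff)
qed

lemma coset_action_mon: "coset_action G T \<in> mon (TopAutoGroup G T) (BijGroup (rp_cosets G T))"
proof -
  have "inj_on (coset_action G T) (top_auto G T)"
  proof (intro inj_onI extensionalityI[where A = "carrier G"])
    fix \<alpha> \<beta> x
    assume \<alpha>: "\<alpha> \<in> top_auto G T" and \<beta>: "\<beta> \<in> top_auto G T"
      and eq: "coset_action G T \<alpha> = coset_action G T \<beta>" and x: "x \<in> carrier G"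
    obtain \<gamma> where \<gamma>: "\<gamma> \<in> top_auto G T" "\<And>x. x \<in> carrier G \<Longrightarrow> \<alpha> (\<gamma> x) = x"
      "\<And>x. x \<in> carrier G \<Longrightarrow> \<gamma> (\<alpha> x) = x" using top_auto_inverse[OF \<alpha>] by blast
    show "\<alpha> x = \<beta> x"
    proof (rule ccontr)
      assume "\<alpha> x \<noteq> \<beta> x"
      then obtain A where A: "A \<in> rp_cosets G T" "\<alpha> x \<in> A" "\<beta> x \<notin> A"
        using rp_cosets_separate[of "\<alpha> x" "\<beta> x"] top_autoD(4) \<alpha> \<beta> x by metis
      \<comment> \<open>The coset \<gamma>(A) contains x, and both actions send it to
        \<alpha>(\<gamma>(A)) = A, so \<beta> x would have to lie in A.\<close>
      have B: "\<gamma> ` A \<in> rp_cosets G T" by (rule top_auto_image_rp_cosets[OF \<gamma>(1) A(1)])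
      have "x \<in> \<gamma> ` A" using \<gamma>(3)[OF x] A(2) by (metis imageI)
      then have "\<beta> x \<in> coset_action G T \<beta> (\<gamma> ` A)" using B by (simp add: coset_action_def)
      also have "\<dots> = \<alpha> ` \<gamma> ` A" using B by (simp add: eq[symmetric]) (simp add: coset_action_def)
      finally show False using A(1,3) top_auto_inverse_image[of \<alpha> \<gamma>, OF \<gamma>(2)] by simp
    qed
  qed (auto intro: top_autoD(3))
  then show ?thesis by (simp add: mon_def coset_action_hom carrier_TopAutoGroup)
qed

text \<open>This is membership in the closure of the range of \<open>coset_action\<close>, by
  \<open>closedin_sym_topology_iff\<close>, written with plain images. The automorphism may vary
  with F.\<close>

definition approximable :: "('a set \<Rightarrow> 'a set) \<Rightarrow> bool" where
  "approximable f \<longleftrightarrow> f \<in> Bij (rp_cosets G T) \<and>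
    (\<forall>F. finite F \<longrightarrow> F \<subseteq> rp_cosets G T \<longrightarrow> (\<exists>\<alpha>\<in>top_auto G T. \<forall>A\<in>F. \<alpha> ` A = f A))"

lemma approximableD:
  "approximable f \<Longrightarrow> finite F \<Longrightarrow> F \<subseteq> rp_cosets G T \<Longrightarrow> \<exists>\<alpha>\<in>top_auto G T. \<forall>A\<in>F. \<alpha> ` A = f A"
  by (simp add: approximable_def)

lemma approximable_mem: "approximable f \<Longrightarrow> A \<in> rp_cosets G T \<Longrightarrow> f A \<in> rp_cosets G T"
  using funcset_mem[OF Bij_imp_funcset] by (auto simp: approximable_def)

text \<open>If \<alpha> agrees with f on the sets \<open>f' A\<close> for A in F, then the inverse
  of \<alpha> agrees with \<open>f'\<close> on F. Thus f and its inverse can be treated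
  symmetrically.\<close>

lemma approximable_inverse:
  assumes f: "approximable f"
  obtains f' where "approximable f'" "\<And>A. A \<in> rp_cosets G T \<Longrightarrow> f (f' A) = A"
    "\<And>A. A \<in> rp_cosets G T \<Longrightarrow> f' (f A) = A"
proof
  let ?W = "rp_cosets G T"
  let ?f' = "restrict (inv_into ?W f) ?W"
  have bij: "bij_betw f ?W ?W" and Bij: "f \<in> Bij ?W" using f by (auto simp: approximable_def Bij_def)
  show right: "f (?f' A) = A" if "A \<in> ?W" for A using that bij by (simp add: bij_betw_inv_into_right)
  show "?f' (f A) = A" if "A \<in> ?W" for A
    using that bij approximable_mem[OF f] by (simp add: bij_betw_inv_into_left)
  have Bij': "?f' \<in> Bij ?W" using Bij by (rule restrict_inv_into_Bij)
  show "approximable ?f'"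
    unfolding approximable_def
  proof (intro conjI allI impI Bij')
    fix F assume F: "finite F" "F \<subseteq> ?W"
    have "?f' ` F \<subseteq> ?W" using F(2) funcset_mem[OF Bij_imp_funcset[OF Bij']] by blast
    then have "\<exists>\<alpha>\<in>top_auto G T. \<forall>A\<in>?f' ` F. \<alpha> ` A = f A"
      by (rule approximableD[OF f finite_imageI[OF F(1)]])
    then obtain \<alpha> where \<alpha>: "\<alpha> \<in> top_auto G T" "\<forall>A\<in>?f' ` F. \<alpha> ` A = f A" by (elim bexE)
    obtain \<beta> where \<beta>: "\<beta> \<in> top_auto G T" "\<And>x. x \<in> carrier G \<Longrightarrow> \<alpha> (\<beta> x) = x"
      "\<And>x. x \<in> carrier G \<Longrightarrow> \<beta> (\<alpha> x) = x" using top_auto_inverse[OF \<alpha>(1)] by blast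
    have "\<beta> ` A = ?f' A" if A: "A \<in> F" for A
    proof -
      have "\<alpha> ` ?f' A = A" using \<alpha>(2) A right[of A] F(2) by blast
      then have "\<beta> ` A = \<beta> ` \<alpha> ` ?f' A" by simp
      also have "\<dots> = ?f' A"
        using \<open>?f' ` F \<subseteq> ?W\<close> A by (intro top_auto_inverse_image[of \<beta> \<alpha>, OF \<beta>(3)]) blast+
      finally show ?thesis .
    qed
    with \<beta>(1) show "\<exists>\<alpha>\<in>top_auto G T. \<forall>A\<in>F. \<alpha> ` A = ?f' A" by blast
  qed
qed

lemma approximable_point:
  assumes f: "approximable f" and g: "g \<in> carrier G"
  shows "\<exists>h\<in>carrier G. \<forall>A\<in>rp_cosets G T. g \<in> A \<longrightarrow> h \<in> f A"
proof -
  let ?W = "rp_cosets G T"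
  let ?\<C> = "f ` {A \<in> ?W. g \<in> A}"
  \<comment> \<open>These are the two smallness conditions of \<open>complete\<close>: each V bounds
    some f(A) with g in A by a left translate, and another by a right translate.\<close>
  have cosets: "\<exists>U c. roelcke_precompact_open_subgroup U G T \<and> c \<in> carrier G
      \<and> f (g <# U) = c <# V" "\<exists>U c. roelcke_precompact_open_subgroup U G T \<and> c \<in> carrier G
      \<and> f (U #> g) = V #> c"
    if V: "roelcke_precompact_open_subgroup V G T" for V
  proof -
    \<comment> \<open>The required U is \<open>f' V\<close>, the coset that f carries to V. It is a
      Roelcke precompact open subgroup because an approximating automorphism carries it to V and the
      inverse automorphism carries V back.\<close>
    obtain f' where f': "approximable f'" "f (f' V) = V"
      using approximable_inverse[OF f] rp_cosetsI(3)[OF V g] by metis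
    have UW: "f' V \<in> ?W" using approximable_mem[OF f'(1)] rp_cosetsI(3)[OF V g] .
    obtain \<alpha> where \<alpha>: "\<alpha> \<in> top_auto G T" "\<alpha> ` f' V = V"
      using approximableD[OF f, of "{f' V}"] UW f'(2) by auto
    obtain \<beta> where \<beta>: "\<beta> \<in> top_auto G T" "\<And>x. x \<in> carrier G \<Longrightarrow> \<alpha> (\<beta> x) = x"
      "\<And>x. x \<in> carrier G \<Longrightarrow> \<beta> (\<alpha> x) = x" using top_auto_inverse[OF \<alpha>(1)] by blast
    have U: "roelcke_precompact_open_subgroup (f' V) G T"
      using top_auto_image_roelcke_precompact[OF \<beta>(1) V]
        top_auto_inverse_image[of \<beta> \<alpha>, OF \<beta>(3) UW] by (simp only: \<alpha>(2))
    note Uc = rp_open_subgroupD(3)[OF U]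
    \<comment> \<open>One automorphism treats three cosets at once, so with U = \<open>f' V\<close>
      it gives f(gU) = \<gamma>(g)V and f(Ug) = V\<gamma>(g).\<close>
    obtain \<gamma> where \<gamma>: "\<gamma> \<in> top_auto G T" "\<gamma> ` f' V = V" "\<gamma> ` (g <# f' V) = f (g <# f' V)"
        "\<gamma> ` (f' V #> g) = f (f' V #> g)"
      using approximableD[OF f, of "{f' V, g <# f' V, f' V #> g}"] rp_cosetsI[OF U g] f'(2) by auto
    then show "\<exists>U c. roelcke_precompact_open_subgroup U G T \<and> c \<in> carrier G \<and> f (g <# U) = c <# V"
      "\<exists>U c. roelcke_precompact_open_subgroup U G T \<and> c \<in> carrier G \<and> f (U #> g) = V #> c"
      using U top_auto_image_l_coset[OF \<gamma>(1) g Uc] top_auto_image_r_coset[OF \<gamma>(1) g Uc]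
        top_autoD(4)[OF \<gamma>(1) g] by metis+
  qed
  have "\<exists>h\<in>carrier G. \<forall>C\<in>?\<C>. h \<in> C"
  proof (rule complete)
    show "closedin T C" if "C \<in> ?\<C>" for C
      using that closedin_rp_cosets approximable_mem[OF f] by auto
    show "carrier G \<inter> \<Inter>\<D> \<noteq> {}" if \<D>: "finite \<D>" "\<D> \<subseteq> ?\<C>" for \<D>
    proof -
      obtain F where F: "F \<subseteq> {A \<in> ?W. g \<in> A}" "finite F" "\<D> = f ` F"
        using finite_subset_image[OF \<D>] by blast
      then obtain \<alpha> where \<alpha>: "\<alpha> \<in> top_auto G T" "\<forall>A\<in>F. \<alpha> ` A = f A" using approximableD[OF f, of F] by auto
      \<comment> \<open>As g lies in each A in F, its image \<alpha> g lies in each \<alpha>(A) =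
        f(A).\<close>
      have "\<alpha> g \<in> carrier G \<inter> \<Inter>\<D>" using \<alpha> F top_autoD(4)[OF \<alpha>(1) g] by fastforce
      then show ?thesis by blast
    qed
    fix V assume V: "roelcke_precompact_open_subgroup V G T"
    show "\<exists>C\<in>?\<C>. \<exists>c\<in>carrier G. C \<subseteq> c <# V"
    proof -
      obtain U c where U: "roelcke_precompact_open_subgroup U G T" "c \<in> carrier G"
        "f (g <# U) = c <# V" using cosets(1)[OF V] by blast
      then have "f (g <# U) \<in> ?\<C>"
        using rp_cosetsI(1)[OF U(1) g] lcos_self[OF g rp_open_subgroupD(1)] by blast
      then show ?thesis using U by blast
    qed
    show "\<exists>C\<in>?\<C>. \<exists>c\<in>carrier G. C \<subseteq> V #> c"
    proof -
      obtain U c where U: "roelcke_precompact_open_subgroup U G T" "c \<in> carrier G"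
        "f (U #> g) = V #> c" using cosets(2)[OF V] by blast
      then have "f (U #> g) \<in> ?\<C>"
        using rp_cosetsI(2)[OF U(1) g] rcos_self[OF g rp_open_subgroupD(1)] by blast
      then show ?thesis using U by blast
    qed
  qed
  then show ?thesis by blast
qed

text \<open>Since f is onto \<open>rp_cosets\<close>, each basic open set A is \<open>f B\<close>
  for a coset B, and by \<open>iff\<close> the preimage of A under \<phi> is the open set B.\<close>

lemma continuous_map_from_cosets:
  assumes f: "f \<in> Bij (rp_cosets G T)" and \<phi>: "\<And>x. x \<in> carrier G \<Longrightarrow> \<phi> x \<in> carrier G"
    and iff: "\<And>x A. x \<in> carrier G \<Longrightarrow> A \<in> rp_cosets G T \<Longrightarrow> \<phi> x \<in> f A \<longleftrightarrow> x \<in> A"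
  shows "continuous_map T T \<phi>"
  unfolding continuous_map_def topspace_eq_carrier
proof (intro conjI allI impI)
  fix N assume N: "openin T N"
  show "openin T {x \<in> carrier G. \<phi> x \<in> N}"
  proof (subst openin_subopen, intro ballI)
    fix x assume x: "x \<in> {x \<in> carrier G. \<phi> x \<in> N}"
    then obtain A where A: "A \<in> rp_cosets G T" "\<phi> x \<in> A" "A \<subseteq> N"
      using rp_cosets_basis[OF N] by blast
    have "A \<in> f ` rp_cosets G T" using f A(1) by (simp add: Bij_def bij_betw_def)
    then obtain B where B: "B \<in> rp_cosets G T" "A = f B" by blast
    then have "openin T B \<and> x \<in> B \<and> B \<subseteq> {x \<in> carrier G. \<phi> x \<in> N}"
      using A x iff[OF _ B(1)] openin_rp_cosets[OF B(1)] rp_cosets_subset[OF B(1)] by blast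
    then show "\<exists>B. openin T B \<and> x \<in> B \<and> B \<subseteq> {x \<in> carrier G. \<phi> x \<in> N}" by blast
  qed
qed (use \<phi> in auto)

lemma approximable_imp_coset_action:
  assumes f: "approximable f"
  shows "f \<in> coset_action G T ` top_auto G T"
proof -
  let ?W = "rp_cosets G T"
  obtain f' where f': "approximable f'" "\<And>A. A \<in> ?W \<Longrightarrow> f (f' A) = A"
    "\<And>A. A \<in> ?W \<Longrightarrow> f' (f A) = A" using approximable_inverse[OF f] by blast
  note mem = approximable_mem[OF f] and mem' = approximable_mem[OF f'(1)]
  \<comment> \<open>Choice turns the common points into functions; all further properties are
    recovered from these membership conditions.\<close>
  obtain \<phi> where \<phi>: "\<And>x. x \<in> carrier G \<Longrightarrow> \<phi> x \<in> carrier G"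
    "\<And>x A. x \<in> carrier G \<Longrightarrow> A \<in> ?W \<Longrightarrow> x \<in> A \<Longrightarrow> \<phi> x \<in> f A"
    using approximable_point[OF f] by metis
  obtain \<psi> where \<psi>: "\<And>x. x \<in> carrier G \<Longrightarrow> \<psi> x \<in> carrier G"
    "\<And>x A. x \<in> carrier G \<Longrightarrow> A \<in> ?W \<Longrightarrow> x \<in> A \<Longrightarrow> \<psi> x \<in> f' A"
    using approximable_point[OF f'(1)] by metis
  have \<psi>\<phi>: "\<psi> (\<phi> x) = x" if x: "x \<in> carrier G" for x
  proof (rule ccontr)
    assume "\<psi> (\<phi> x) \<noteq> x"
    \<comment> \<open>As x is in A, \<phi> x is in \<open>f A\<close> and \<psi> (\<phi> x) is in
      \<open>f' (f A)\<close>, which is A.\<close>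
    then obtain A where A: "A \<in> ?W" "x \<in> A" "\<psi> (\<phi> x) \<notin> A"
      using rp_cosets_separate[of x "\<psi> (\<phi> x)"] \<phi>(1) \<psi>(1) x by metis
    have "\<psi> (\<phi> x) \<in> f' (f A)" by (intro \<phi> \<psi> mem x A)
    with A f'(3) show False by simp
  qed
  have \<phi>\<psi>: "\<phi> (\<psi> x) = x" if x: "x \<in> carrier G" for x
  proof (rule ccontr)
    assume "\<phi> (\<psi> x) \<noteq> x"
    then obtain A where A: "A \<in> ?W" "x \<in> A" "\<phi> (\<psi> x) \<notin> A"
      using rp_cosets_separate[of x "\<phi> (\<psi> x)"] \<phi>(1) \<psi>(1) x by metis
    have "\<phi> (\<psi> x) \<in> f (f' A)" by (intro \<phi> \<psi> mem' x A)
    with A f'(2) show False by simp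
  qed
  \<comment> \<open>From right to left this is the choice of \<phi>. Conversely, \<psi> takes a
    point \<phi> x of \<open>f A\<close> into \<open>f' (f A) = A\<close>, and \<psi> (\<phi> x) =
    x.\<close>
  have iff: "\<phi> x \<in> f A \<longleftrightarrow> x \<in> A" if "x \<in> carrier G" "A \<in> ?W" for x A
    using \<phi>(2)[OF that] \<psi>(2)[OF \<phi>(1)[OF that(1)] mem[OF that(2)]] that \<psi>\<phi> f'(3) by auto
  have iff': "\<psi> x \<in> f' A \<longleftrightarrow> x \<in> A" if "x \<in> carrier G" "A \<in> ?W" for x A
    using \<psi>(2)[OF that] \<phi>(2)[OF \<psi>(1)[OF that(1)] mem'[OF that(2)]] that \<phi>\<psi> f'(2) by auto
  have "continuous_map T T \<phi>"
    using f \<phi>(1) iff by (intro continuous_map_from_cosets[of f]) (auto simp: approximable_def)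
  moreover have "continuous_map T T \<psi>"
    using f' \<psi>(1) iff' by (intro continuous_map_from_cosets[of f']) (auto simp: approximable_def)
  ultimately have "homeomorphic_maps T T \<phi> \<psi>"
    using \<psi>\<phi> \<phi>\<psi> by (simp add: homeomorphic_maps_def topspace_eq_carrier)
  then have homeo: "homeomorphic_map T T \<phi>" by (auto simp: homeomorphic_map_maps)
  have mult: "\<phi> (x \<otimes> y) = \<phi> x \<otimes> \<phi> y" if x: "x \<in> carrier G" and y: "y \<in> carrier G" for x y
  proof (rule ccontr)
    assume "\<phi> (x \<otimes> y) \<noteq> \<phi> x \<otimes> \<phi> y"
    then obtain A' where A': "A' \<in> ?W" "\<phi> (x \<otimes> y) \<in> A'" "\<phi> x \<otimes> \<phi> y \<notin> A'"
      using rp_cosets_separate[of "\<phi> (x \<otimes> y)" "\<phi> x \<otimes> \<phi> y"] \<phi>(1) x y by (metis m_closed)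
    \<comment> \<open>Pulling A' back by f gives a coset containing x \<otimes> y, so that
      continuity of the product can be applied at (x, y) itself.\<close>
    define A where "A = f' A'"
    have A: "A \<in> ?W" "f A = A'" using mem' f'(2) A'(1) by (auto simp: A_def)
    then have xyA: "x \<otimes> y \<in> A" using A'(2) iff x y by auto
    let ?S = "{p \<in> topspace (prod_topology T T). (\<lambda>(x, y). x \<otimes> y) p \<in> A}"
    have "openin (prod_topology T T) ?S"
      by (rule openin_continuous_map_preimage[OF continuous_mult openin_rp_cosets[OF A(1)]])
    moreover have "(x, y) \<in> ?S" using x y xyA by (simp add: topspace_eq_carrier)
    ultimately obtain N M where NM: "openin T N" "openin T M" "x \<in> N" "y \<in> M" "N \<times> M \<subseteq> ?S"
      using openin_prod_topology_alt[of T T ?S] by blast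
    obtain C where C: "C \<in> ?W" "x \<in> C" "C \<subseteq> N" by (rule rp_cosets_basis[OF NM(1,3)])
    obtain D where D: "D \<in> ?W" "y \<in> D" "D \<subseteq> M" by (rule rp_cosets_basis[OF NM(2,4)])
    \<comment> \<open>The points \<phi> x and \<phi> y lie in \<alpha>(C) and \<alpha>(D), so they
      are \<alpha> c and \<alpha> d, where c and d may differ from x and y. Products of C with D
      stay in A, so \<phi> x \<otimes> \<phi> y = \<alpha> (c \<otimes> d) lies in \<alpha>(A) = A',
      a contradiction.\<close>
    obtain \<alpha> where \<alpha>: "\<alpha> \<in> top_auto G T" "\<alpha> ` A = f A" "\<alpha> ` C = f C" "\<alpha> ` D = f D"
      using approximableD[OF f, of "{A, C, D}"] A(1) C(1) D(1) by auto
    obtain c d where cd: "c \<in> C" "\<phi> x = \<alpha> c" "d \<in> D" "\<phi> y = \<alpha> d"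
      using \<phi>(2)[OF x C(1,2)] \<phi>(2)[OF y D(1,2)] \<alpha> by blast
    have "(c, d) \<in> ?S" using cd(1,3) C(3) D(3) NM(5) by blast
    then have "c \<otimes> d \<in> A" by simp
    then have "\<alpha> (c \<otimes> d) \<in> f A" using \<alpha>(2) by blast
    moreover have "c \<in> carrier G" "d \<in> carrier G"
      using cd rp_cosets_subset C(1) D(1) by blast+
    ultimately show False using A'(3) A(2) cd top_autoD(5)[OF \<alpha>(1)] by simp
  qed
  define \<alpha> where "\<alpha> = restrict \<phi> (carrier G)"
  have "\<alpha> \<in> top_auto G T"
    by (rule top_autoI) (use homeomorphic_map_eq[OF homeo, of \<alpha>] mult in
        \<open>auto simp: \<alpha>_def topspace_eq_carrier\<close>)
  moreover have "f = coset_action G T \<alpha>"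
  proof (rule extensionalityI[where A = ?W])
    show "f \<in> extensional ?W" using f by (simp add: approximable_def Bij_def)
    show "coset_action G T \<alpha> \<in> extensional ?W" by (simp add: coset_action_def)
    fix A assume A: "A \<in> ?W"
    have "f A = \<phi> ` A"
    proof
      show "\<phi> ` A \<subseteq> f A" using \<phi>(2) A rp_cosets_subset[OF A] by blast
      show "f A \<subseteq> \<phi> ` A"
      proof
        fix z assume z: "z \<in> f A"
        then have "z \<in> carrier G" using rp_cosets_subset[OF mem[OF A]] by blast
        \<comment> \<open>Write z as \<phi> (\<psi> z); then \<open>iff\<close> puts \<psi> z into
          A.\<close>
        then show "z \<in> \<phi> ` A" using iff[OF \<psi>(1) A] z \<phi>\<psi> by (metis imageI)
      qed
    qed
    also have "\<dots> = \<alpha> ` A" using rp_cosets_subset[OF A] by (intro image_cong) (auto simp: \<alpha>_def)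
    finally show "f A = coset_action G T \<alpha> A" using A by (simp add: coset_action_def)
  qed
  ultimately show ?thesis by blast
qed

lemma closedin_coset_action:
  "closedin (sym_topology (rp_cosets G T)) (coset_action G T ` carrier (TopAutoGroup G T))"
  unfolding closedin_sym_topology_iff carrier_TopAutoGroup
proof (intro conjI ballI impI)
  fix f assume f: "f \<in> Bij (rp_cosets G T)"
    "\<forall>F. finite F \<longrightarrow> F \<subseteq> rp_cosets G T \<longrightarrow>
      (\<exists>h\<in>coset_action G T ` top_auto G T. \<forall>A\<in>F. h A = f A)"
  have "\<exists>\<alpha>\<in>top_auto G T. \<forall>A\<in>F. \<alpha> ` A = f A" if F: "finite F" "F \<subseteq> rp_cosets G T" for F
  proof -
    obtain \<alpha> where "\<alpha> \<in> top_auto G T" "\<forall>A\<in>F. coset_action G T \<alpha> A = f A" using f(2) F by auto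
    then show ?thesis using F(2) by (intro bexI[of _ \<alpha>]) (auto simp: coset_action_def subset_iff)
  qed
  then have "approximable f" using f(1) by (auto simp: approximable_def)
  then show "f \<in> coset_action G T ` top_auto G T" by (rule approximable_imp_coset_action)
qed (use coset_action_Bij in auto)

end

section \<open>Closed permutation groups\<close>

text \<open>For finite F these stabilisers, intersected with one Roelcke precompact open subgroup,
  yield the small subgroups demanded by \<open>small_rp\<close>.\<close>

lemma subgroup_stabiliser:
  assumes "F \<subseteq> X"
  shows "subgroup {h \<in> Bij X. \<forall>x\<in>F. h x = x} (BijGroup X)"
proof (rule group.subgroupI[OF group_BijGroup])
  show "{h \<in> Bij X. \<forall>x\<in>F. h x = x} \<subseteq> carrier (BijGroup X)" by (auto simp: BijGroup_def)
  show "{h \<in> Bij X. \<forall>x\<in>F. h x = x} \<noteq> {}"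
    using id_Bij[of X] assms by (auto intro!: exI[of _ "\<lambda>x\<in>X. x"])
  fix a assume a: "a \<in> {h \<in> Bij X. \<forall>x\<in>F. h x = x}"
  have "inv_into X a x = x" if "x \<in> F" for x
    using a that assms by (intro inv_into_f_eq) (auto simp: Bij_def bij_betw_def)
  then show "inv\<^bsub>BijGroup X\<^esub> a \<in> {h \<in> Bij X. \<forall>x\<in>F. h x = x}"
    using a assms restrict_inv_into_Bij[of a X] by (auto simp: inv_BijGroup)
  fix b assume "b \<in> {h \<in> Bij X. \<forall>x\<in>F. h x = x}"
  then show "a \<otimes>\<^bsub>BijGroup X\<^esub> b \<in> {h \<in> Bij X. \<forall>x\<in>F. h x = x}"
    using a assms by (auto simp: BijGroup_def compose_Bij compose_eq)
qed

text \<open>Completeness passes from the symmetric group to H because sets closed in H are closed in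
  \<open>Bij X\<close>. A left coset of a subgroup fixing x determines the image of x, and a right
  coset determines the preimage of x.\<close>

lemma complete_rp_group_closed_subgroup:
  assumes H: "subgroup H (BijGroup X)" and closed: "closedin (sym_topology X) H"
    and G: "G = (BijGroup X)\<lparr>carrier := H\<rparr>" and T: "T = subtopology (sym_topology X) H"
    and rp: "locally_roelcke_precompact G T"
  shows "complete_rp_group G T"
proof -
  interpret topological_group G T using rp by (simp add: locally_roelcke_precompact_def)
  have carrier: "carrier G = H" by (simp add: G)
  have HB: "H \<subseteq> Bij X" using subgroup.subset[OF H] by (simp add: BijGroup_def)
  have one: "\<one>\<^bsub>G\<^esub> = (\<lambda>x\<in>X. x)" by (simp add: G BijGroup_def)
  have mult: "g \<otimes>\<^bsub>G\<^esub> h = compose X g h" if "g \<in> H" "h \<in> H" for g h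
    using that HB by (auto simp: G BijGroup_def)
  obtain K where K: "roelcke_precompact_open_subgroup K G T"
    using rp by (auto simp: locally_roelcke_precompact_def)
  have small: "\<exists>V. roelcke_precompact_open_subgroup V G T \<and> V \<subseteq> {h \<in> H. \<forall>x\<in>F. h x = x}"
    if F: "finite F" "F \<subseteq> X" for F
  proof -
    let ?S = "H \<inter> {h \<in> Bij X. \<forall>x\<in>F. h x = x}"
    have "subgroup ?S (BijGroup X)"
      using group.subgroups_Inter_pair[OF group_BijGroup H subgroup_stabiliser[OF F(2)]] .
    then have "subgroup ?S G"
      using group.subgroup_incl[OF group_BijGroup _ H] by (simp add: G)
    moreover have "openin T ?S"
      using openin_sym_topology_agree[OF F, of "\<lambda>x. x"]
      by (simp add: T openin_subtopology_Int2)
    \<comment> \<open>The stabiliser itself may fail to be Roelcke precompact; intersecting it with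
      K makes it an open subgroup of a Roelcke precompact one.\<close>
    ultimately have "open_subgroup (K \<inter> ?S) G T"
      using rp_open_subgroupD(1,2)[OF K] by (simp add: open_subgroup_def subgroups_Inter_pair openin_Int)
    then have "roelcke_precompact_open_subgroup (K \<inter> ?S) G T"
      by (rule roelcke_precompact_open_subgroup_mono[OF K]) simp
    then show ?thesis by (intro exI[of _ "K \<inter> ?S"]) auto
  qed
  show ?thesis
  proof unfold_locales
    show "Hausdorff_space T"
      unfolding T sym_topology_def
      by (intro Hausdorff_space_subtopology) (simp add: Hausdorff_space_product_topology)
  next
    fix N assume N: "openin T N" "\<one>\<^bsub>G\<^esub> \<in> N"
    then obtain N' where N': "openin (sym_topology X) N'" "N = N' \<inter> H"
      by (auto simp: T openin_subtopology)
    \<comment> \<open>The unit is the identity on X, so agreeing with it on F means fixing F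
      pointwise.\<close>
    then obtain F where F: "finite F" "F \<subseteq> X" "{h \<in> Bij X. \<forall>x\<in>F. h x = \<one>\<^bsub>G\<^esub> x} \<subseteq> N'"
      using sym_topology_nbhd[OF N'(1), of "\<one>\<^bsub>G\<^esub>"] N(2) by blast
    then have "{h \<in> H. \<forall>x\<in>F. h x = x} \<subseteq> N" using HB N'(2) by (auto simp: one subset_iff)
    then show "\<exists>V. roelcke_precompact_open_subgroup V G T \<and> V \<subseteq> N"
      using small[OF F(1,2)] by blast
  next
    fix \<C>
    assume cl: "\<And>C. C \<in> \<C> \<Longrightarrow> closedin T C"
      and fip: "\<And>\<D>. finite \<D> \<Longrightarrow> \<D> \<subseteq> \<C> \<Longrightarrow> carrier G \<inter> \<Inter>\<D> \<noteq> {}"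
      and left: "\<And>V. roelcke_precompact_open_subgroup V G T \<Longrightarrow>
        \<exists>C\<in>\<C>. \<exists>g\<in>carrier G. C \<subseteq> g <#\<^bsub>G\<^esub> V"
      and right: "\<And>V. roelcke_precompact_open_subgroup V G T \<Longrightarrow>
        \<exists>C\<in>\<C>. \<exists>g\<in>carrier G. C \<subseteq> V #>\<^bsub>G\<^esub> g"
    \<comment> \<open>Adding H, itself closed, to the family forces the common point to lie in
      H.\<close>
    have "\<exists>b\<in>Bij X. \<forall>C\<in>insert H \<C>. b \<in> C"
    proof (rule sym_topology_complete)
      show "closedin (sym_topology X) C" if "C \<in> insert H \<C>" for C
        using that cl closed closedin_trans_full by (auto simp: T)
      show "Bij X \<inter> \<Inter>\<D> \<noteq> {}" if \<D>: "finite \<D>" "\<D> \<subseteq> insert H \<C>" for \<D>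
      proof -
        \<comment> \<open>\<open>fip\<close> concerns subfamilies of \<C>, so H is split off and
          returns as the carrier.\<close>
        have "H \<inter> \<Inter>(\<D> - {H}) \<noteq> {}" using fip[of "\<D> - {H}"] \<D> by (auto simp: carrier)
        then show ?thesis using HB by blast
      qed
      fix x assume x: "x \<in> X"
      obtain V where V: "roelcke_precompact_open_subgroup V G T" "V \<subseteq> {h \<in> H. h x = x}"
        using small[of "{x}"] x by auto
      show "\<exists>C\<in>insert H \<C>. \<exists>y. \<forall>h\<in>C. h x = y"
      proof -
        obtain C g where C: "C \<in> \<C>" "g \<in> H" "C \<subseteq> g <#\<^bsub>G\<^esub> V" using left[OF V(1)] carrier by blast
        \<comment> \<open>Elements of V fix x, so h = gv gives h x = g (v x) = g x.\<close>
        have "h x = g x" if h: "h \<in> C" for h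
        proof -
          obtain v where "v \<in> V" "h = g \<otimes>\<^bsub>G\<^esub> v" using C(3) h by (auto simp: l_coset_def)
          then show ?thesis using V(2) C(2) x by (auto simp: mult compose_eq)
        qed
        then show ?thesis using C(1) by blast
      qed
      show "\<exists>C\<in>insert H \<C>. \<exists>y\<in>X. \<forall>h\<in>C. h y = x"
      proof -
        obtain C g where C: "C \<in> \<C>" "g \<in> H" "C \<subseteq> V #>\<^bsub>G\<^esub> g" using right[OF V(1)] carrier by blast
        \<comment> \<open>The common argument is the preimage y of x under g: for h = vg one has h y
          = v (g y) = v x = x.\<close>
        have "x \<in> g ` X" using C(2) HB x by (auto simp: Bij_def bij_betw_def)
        then obtain y where y: "y \<in> X" "g y = x" by blast
        have "h y = x" if h: "h \<in> C" for h
        proof -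
          obtain v where "v \<in> V" "h = v \<otimes>\<^bsub>G\<^esub> g" using C(3) h by (auto simp: r_coset_def)
          then show ?thesis using V(2) C(2) y by (auto simp: mult compose_eq)
        qed
        then show ?thesis using C(1) y(1) by blast
      qed
    qed
    then show "\<exists>x\<in>carrier G. \<forall>C\<in>\<C>. x \<in> C" by (auto simp: carrier)
  qed
qed

theorem proposition6p9:
  fixes H :: "(nat \<Rightarrow> nat) set"
    and G :: "(nat \<Rightarrow> nat) monoid"
    and T :: "(nat \<Rightarrow> nat) topology"
  assumes "subgroup H (BijGroup (UNIV :: nat set))"
    and "closedin (sym_topology (UNIV :: nat set)) H"
    and "infinite H"
    and "G = (BijGroup (UNIV :: nat set))\<lparr>carrier := H\<rparr>"
    and "T = subtopology (sym_topology (UNIV :: nat set)) H"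
    and "locally_roelcke_precompact G T"
  shows "coset_action G T \<in> mon (TopAutoGroup G T) (BijGroup (rp_cosets G T))
    \<and> closedin (sym_topology (rp_cosets G T)) (coset_action G T ` carrier (TopAutoGroup G T))"
proof -
  interpret complete_rp_group G T
    using assms by (intro complete_rp_group_closed_subgroup)
  show ?thesis using coset_action_mon closedin_coset_action by blast
qed

end
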